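(* Let $\mathcal{A}\in\mathbb{H}^{m\times n\times m\times n}$ be a nonzero fourth order hierarchically symmetric tensor, and let $\lambda^*$ be the largest M-eigenvalue of $\mathcal{A}$. Consider the unconstrained problem $$\min_{\mathbf{x}\in\mathbb{R}^m,\ \mathbf{y}\in\mathbb{R}^n} f(\mathbf{x},\mathbf{y})=\tfrac14(\mathbf{x}^\top\mathbf{x})^2(\mathbf{y}^\top\mathbf{y})^2-\tfrac12\mathcal{A}\mathbf{x}\mathbf{y}\mathbf{x}\mathbf{y}.$$ Then: (1) The problem has a global minimum. (2) Let $\mathbf{x}\in\mathbb{R}^m\setminus\{\mathbf{0}\}$ and $\mathbf{y}\in\mathbb{R}^n\setminus\{\mathbf{0}\}$ be such that $(\mathbf{x},\mathbf{y})$ is a critical point of $f$. Then $\lambda=(\mathbf{x}^\top\mathbf{x})(\mathbf{y}^\top\mathbf{y})$ is a positive M-eigenvalue of $\mathcal{A}$, with associated M-eigenvectors $\mathbf{u}=\mathbf{x}/\|\mathbf{x}\|$ (left) and $\mathbf{v}=\mathbf{y}/\|\mathbf{y}\|$ (right). (3) If $\lambda^*>0$, then $f$ attains its global minimum $f_{\min}=-\frac14(\lambda^* )^2$ at nonzero critical points $(\mathbf{x},\mathbf{y})$ (that is, critical points with $\mathbf{x}\neq\mathbf{0}$ and $\mathbf{y}\neq\mathbf{0}$).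
   Context: $\mathbb{H}^{m\times n\times m\times n}$ is the set of fourth order hierarchically symmetric tensors: real tensors $\mathcal{A}=(a_{ijkl})\in\mathbb{R}^{m\times n\times m\times n}$ with $a_{ijkl}=a_{kjil}=a_{ilkj}=a_{klij}$ for all $i,k\in\{1,\dots,m\}$ and $j,l\in\{1,\dots,n\}$. For $\mathbf{x}\in\mathbb{R}^m$, $\mathbf{y}\in\mathbb{R}^n$: $$\mathcal{A}\mathbf{x}\mathbf{y}\mathbf{x}\mathbf{y}=\sum_{i,k=1}^m\sum_{j,l=1}^n a_{ijkl}x_iy_jx_ky_l,$$ $$(\mathcal{A}\mathbf{y}\mathbf{x}\mathbf{y})_i=\sum_{k=1}^m\sum_{j,l=1}^n a_{ijkl}y_jx_ky_l\ (1\le i\le m),\qquad (\mathcal{A}\mathbf{x}\mathbf{y}\mathbf{x})_l=\sum_{i,k=1}^m\sum_{j=1}^n a_{ijkl}x_iy_jx_k\ (1\le l\le n).$$ A real number $\lambda$ is an M-eigenvalue of $\mathcal{A}$, with left M-eigenvector $\mathbf{x}\in\mathbb{R}^m\setminus\{\mathbf{0}\}$ and right M-eigenvector $\mathbf{y}\in\mathbb{R}^n\setminus\{\mathbf{0}\}$, if $\mathcal{A}\mathbf{y}\mathbf{x}\mathbf{y}=\lambda\mathbf{x}$, $\mathcal{A}\mathbf{x}\mathbf{y}\mathbf{x}=\lambda\mathbf{y}$, $\mathbf{x}^\top\mathbf{x}=1$ and $\mathbf{y}^\top\mathbf{y}=1$. A critical point of $f$ is a point where the full gradient (with respect to both $\mathbf{x}$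 and $\mathbf{y}$) vanishes. $\|\cdot\|$ is the Euclidean norm. *)

theory Defs
  imports "HOL-Analysis.Analysis"
begin

text \<open>The entry $a_{ijkl}$ of a tensor in $\mathbb{R}^{m \times n \times m \times n}$ is
  \<open>A $ i $ j $ k $ l\<close>; the dimensions are the cardinalities of the index types.\<close>

definition hier_symmetric :: "real^'n^'m^'n^'m \<Rightarrow> bool" where
  "hier_symmetric A \<longleftrightarrow>
     (\<forall>i j k l. A $ i $ j $ k $ l = A $ k $ j $ i $ l
              \<and> A $ i $ j $ k $ l = A $ i $ l $ k $ j
              \<and> A $ i $ j $ k $ l = A $ k $ l $ i $ j)"

definition biquad_form :: "real^'n^'m^'n^'m \<Rightarrow> real^'m \<Rightarrow> real^'n \<Rightarrow> real" where
  "biquad_form A x y =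
     (\<Sum>i\<in>UNIV. \<Sum>k\<in>UNIV. \<Sum>j\<in>UNIV. \<Sum>l\<in>UNIV. A $ i $ j $ k $ l * x $ i * y $ j * x $ k * y $ l)"

text \<open>The vectors $\mathcal{A}\mathbf{y}\mathbf{x}\mathbf{y}$ (indexed by \<open>i\<close>) and
  $\mathcal{A}\mathbf{x}\mathbf{y}\mathbf{x}$ (indexed by \<open>l\<close>).\<close>

definition tensor_yxy :: "real^'n^'m^'n^'m \<Rightarrow> real^'m \<Rightarrow> real^'n \<Rightarrow> real^'m" where
  "tensor_yxy A x y =
     (\<chi> i. \<Sum>k\<in>UNIV. \<Sum>j\<in>UNIV. \<Sum>l\<in>UNIV. A $ i $ j $ k $ l * y $ j * x $ k * y $ l)"

definition tensor_xyx :: "real^'n^'m^'n^'m \<Rightarrow> real^'m \<Rightarrow> real^'n \<Rightarrow> real^'n" where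
  "tensor_xyx A x y =
     (\<chi> l. \<Sum>i\<in>UNIV. \<Sum>k\<in>UNIV. \<Sum>j\<in>UNIV. A $ i $ j $ k $ l * x $ i * y $ j * x $ k)"

definition M_eigen :: "real^'n^'m^'n^'m \<Rightarrow> real \<Rightarrow> real^'m \<Rightarrow> real^'n \<Rightarrow> bool" where
  "M_eigen A lam x y \<longleftrightarrow>
     x \<noteq> 0 \<and> y \<noteq> 0 \<and>
     tensor_yxy A x y = lam *\<^sub>R x \<and> tensor_xyx A x y = lam *\<^sub>R y \<and>
     x \<bullet> x = 1 \<and> y \<bullet> y = 1"

definition M_eigenvalue :: "real^'n^'m^'n^'m \<Rightarrow> real \<Rightarrow> bool" where
  "M_eigenvalue A lam \<longleftrightarrow> (\<exists>x y. M_eigen A lam x y)"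

text \<open>The operator \<open>GREATEST\<close> is meaningful only when a greatest element exists; for hierarchically symmetric \<open>A\<close> it does, as the
  maximum of \<open>biquad_form A\<close> over the product of the unit spheres.\<close>

definition largest_M_eigenvalue :: "real^'n^'m^'n^'m \<Rightarrow> real" where
  "largest_M_eigenvalue A = (GREATEST lam. M_eigenvalue A lam)"

definition objective :: "real^'n^'m^'n^'m \<Rightarrow> (real^'m) \<times> (real^'n) \<Rightarrow> real" where
  "objective A = (\<lambda>(x, y). 1/4 * (x \<bullet> x)\<^sup>2 * (y \<bullet> y)\<^sup>2 - 1/2 * biquad_form A x y)"

text \<open>On a product space this is the full gradient, with respect to both components; differentiability
  is part of the notion.\<close>

definition critical_point :: "('a::real_inner \<Rightarrow> real) \<Rightarrow> 'a \<Rightarrow> bool" where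
  "critical_point f p \<longleftrightarrow> GDERIV f p :> 0"

definition global_minimizer :: "('a \<Rightarrow> real) \<Rightarrow> 'a \<Rightarrow> bool" where
  "global_minimizer f p \<longleftrightarrow> (\<forall>q. f p \<le> f q)"

end

theory Submission
  imports Defs
begin

text \<open>Let \<open>M\<close> be the maximum of the biquadratic form on the product of the unit spheres. By homogeneity
  \<open>biquad_form A x y \<le> M * s\<close> with \<open>s = (x \<bullet> x) * (y \<bullet> y)\<close>, so the objective is at least
  \<open>s\<^sup>2 / 4 - M * s / 2\<close>, which has minimum \<open>- M\<^sup>2 / 4\<close> at \<open>s = M\<close> if \<open>M > 0\<close> and \<open>0\<close> at \<open>s = 0\<close> otherwise; both
  values are attained. A maximizer on the spheres is a global maximizer of \<open>biquad_form A x y - M * s\<close>,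
  and the vanishing of the gradient there says that \<open>M\<close> is an M-eigenvalue, hence the largest one.\<close>

section \<open>Homogeneity and contraction identities for the multilinear forms\<close>

lemma biquad_form_scaleR:
  "biquad_form A (a *\<^sub>R x) (b *\<^sub>R y) = a\<^sup>2 * b\<^sup>2 * biquad_form A x y"
  unfolding biquad_form_def sum_distrib_left
  by (intro sum.cong refl) (simp add: power2_eq_square)

lemma tensor_yxy_scaleR:
  "tensor_yxy A (a *\<^sub>R x) (b *\<^sub>R y) = (a * b\<^sup>2) *\<^sub>R tensor_yxy A x y"
  unfolding tensor_yxy_def vec_eq_iff
  by (auto simp: sum_distrib_left power2_eq_square intro!: sum.cong)

lemma tensor_xyx_scaleR:
  "tensor_xyx A (a *\<^sub>R x) (b *\<^sub>R y) = (a\<^sup>2 * b) *\<^sub>R tensor_xyx A x y"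
  unfolding tensor_xyx_def vec_eq_iff
  by (auto simp: sum_distrib_left power2_eq_square intro!: sum.cong)

text \<open>The direction \<open>h\<close> replaces one copy of \<open>x\<close> in the form; the
  product rule produces sums of exactly this shape, and \<open>h = x\<close> recovers
  \<open>biquad_form\<close>.\<close>

lemma inner_tensor_yxy:
  "h \<bullet> tensor_yxy A x y =
     (\<Sum>i\<in>UNIV. \<Sum>k\<in>UNIV. \<Sum>j\<in>UNIV. \<Sum>l\<in>UNIV. A $ i $ j $ k $ l * h $ i * y $ j * x $ k * y $ l)"
  unfolding tensor_yxy_def inner_vec_def
  by (auto simp: sum_distrib_left intro!: sum.cong)

lemma inner_tensor_xyx:
  "h \<bullet> tensor_xyx A x y =
     (\<Sum>i\<in>UNIV. \<Sum>k\<in>UNIV. \<Sum>j\<in>UNIV. \<Sum>l\<in>UNIV. A $ i $ j $ k $ l * x $ i * y $ j * x $ k * h $ l)"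
proof -
  have "h \<bullet> tensor_xyx A x y =
     (\<Sum>l\<in>UNIV. \<Sum>i\<in>UNIV. \<Sum>k\<in>UNIV. \<Sum>j\<in>UNIV. A $ i $ j $ k $ l * x $ i * y $ j * x $ k * h $ l)"
    unfolding tensor_xyx_def inner_vec_def
    by (auto simp: sum_distrib_left intro!: sum.cong)
  also have "\<dots> =
     (\<Sum>i\<in>UNIV. \<Sum>l\<in>UNIV. \<Sum>k\<in>UNIV. \<Sum>j\<in>UNIV. A $ i $ j $ k $ l * x $ i * y $ j * x $ k * h $ l)"
    by (rule sum.swap)
  also have "\<dots> =
     (\<Sum>i\<in>UNIV. \<Sum>k\<in>UNIV. \<Sum>l\<in>UNIV. \<Sum>j\<in>UNIV. A $ i $ j $ k $ l * x $ i * y $ j * x $ k * h $ l)"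
    by (intro sum.cong refl sum.swap)
  also have "\<dots> =
     (\<Sum>i\<in>UNIV. \<Sum>k\<in>UNIV. \<Sum>j\<in>UNIV. \<Sum>l\<in>UNIV. A $ i $ j $ k $ l * x $ i * y $ j * x $ k * h $ l)"
    by (intro sum.cong refl sum.swap)
  finally show ?thesis .
qed

lemma biquad_form_eq_inner_yxy: "biquad_form A x y = x \<bullet> tensor_yxy A x y"
  by (simp add: biquad_form_def inner_tensor_yxy)

section \<open>Gradients of the form and of the objective\<close>

lemma GDERIV_biquad_form:
  assumes "hier_symmetric A"
  shows "GDERIV (\<lambda>p. biquad_form A (fst p) (snd p)) (x, y) :>
           (2 *\<^sub>R tensor_yxy A x y, 2 *\<^sub>R tensor_xyx A x y)"
proof -
  have sym: "A $ i $ j $ k $ l = A $ k $ j $ i $ l" "A $ i $ j $ k $ l = A $ i $ l $ k $ j" for i j k l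
    using assms unfolding hier_symmetric_def by blast+
  \<comment> \<open>After exchanging the names \<open>i\<close> and \<open>k\<close>, symmetry moves
    \<open>h\<close> from the third slot to the first. Below, \<open>j\<close> and \<open>l\<close>
    are treated alike. So the four product-rule terms pair up, which gives the factor 2 in both
    components.\<close>
  have k: "(\<Sum>i\<in>UNIV. \<Sum>k\<in>UNIV. \<Sum>j\<in>UNIV. \<Sum>l\<in>UNIV. A $ i $ j $ k $ l * x $ i * y $ j * h $ k * y $ l)
      = h \<bullet> tensor_yxy A x y" for h
    unfolding inner_tensor_yxy
    by (subst sum.swap, intro sum.cong refl) (subst sym(1), simp)
  have j: "(\<Sum>i\<in>UNIV. \<Sum>k\<in>UNIV. \<Sum>j\<in>UNIV. \<Sum>l\<in>UNIV. A $ i $ j $ k $ l * x $ i * h $ j * x $ k * y $ l)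
      = h \<bullet> tensor_xyx A x y" for h
  proof -
    have "(\<Sum>i\<in>UNIV. \<Sum>k\<in>UNIV. \<Sum>j\<in>UNIV. \<Sum>l\<in>UNIV. A $ i $ j $ k $ l * x $ i * h $ j * x $ k * y $ l)
      = (\<Sum>i\<in>UNIV. \<Sum>k\<in>UNIV. \<Sum>l\<in>UNIV. \<Sum>j\<in>UNIV. A $ i $ j $ k $ l * x $ i * h $ j * x $ k * y $ l)"
      by (intro sum.cong refl sum.swap)
    also have "\<dots> = h \<bullet> tensor_xyx A x y"
      unfolding inner_tensor_xyx
      by (intro sum.cong refl) (subst sym(2), simp)
    finally show ?thesis .
  qed
  have "((\<lambda>p. biquad_form A (fst p) (snd p)) has_derivative
     (\<lambda>p. \<Sum>i\<in>UNIV. \<Sum>k\<in>UNIV. \<Sum>j\<in>UNIV. \<Sum>l\<in>UNIV.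
        A $ i $ j $ k $ l * fst p $ i * y $ j * x $ k * y $ l
      + A $ i $ j $ k $ l * x $ i * snd p $ j * x $ k * y $ l
      + A $ i $ j $ k $ l * x $ i * y $ j * fst p $ k * y $ l
      + A $ i $ j $ k $ l * x $ i * y $ j * x $ k * snd p $ l)) (at (x, y))"
    unfolding biquad_form_def
    by (intro has_derivative_sum) (auto intro!: derivative_eq_intros bounded_linear.has_derivative[OF bounded_linear_vec_nth]
        simp: algebra_simps fun_eq_iff)
  moreover have "(\<lambda>p. \<Sum>i\<in>UNIV. \<Sum>k\<in>UNIV. \<Sum>j\<in>UNIV. \<Sum>l\<in>UNIV.
        A $ i $ j $ k $ l * fst p $ i * y $ j * x $ k * y $ l
      + A $ i $ j $ k $ l * x $ i * snd p $ j * x $ k * y $ l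
      + A $ i $ j $ k $ l * x $ i * y $ j * fst p $ k * y $ l
      + A $ i $ j $ k $ l * x $ i * y $ j * x $ k * snd p $ l)
    = (\<lambda>p. p \<bullet> (2 *\<^sub>R tensor_yxy A x y, 2 *\<^sub>R tensor_xyx A x y))"
    by (simp add: fun_eq_iff inner_prod_def sum.distrib k j
        flip: inner_tensor_yxy inner_tensor_xyx)
  ultimately show ?thesis
    unfolding gderiv_def by simp
qed

lemma GDERIV_norm_product:
  "GDERIV (\<lambda>p. (fst p \<bullet> fst p) * (snd p \<bullet> snd p)) (x, y) :>
     ((2 * (y \<bullet> y)) *\<^sub>R x, (2 * (x \<bullet> x)) *\<^sub>R y)"
  for x :: "'a::real_inner" and y :: "'b::real_inner"
  unfolding gderiv_def
  by (auto intro!: derivative_eq_intros simp: algebra_simps fun_eq_iff inner_prod_def inner_commute)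

lemma GDERIV_objective:
  assumes "hier_symmetric A"
  shows "GDERIV (objective A) (x, y) :>
           (((x \<bullet> x) * (y \<bullet> y)\<^sup>2) *\<^sub>R x - tensor_yxy A x y,
            ((x \<bullet> x)\<^sup>2 * (y \<bullet> y)) *\<^sub>R y - tensor_xyx A x y)"
proof -
  \<comment> \<open>Written as a square of \<open>(x \<bullet> x) * (y \<bullet> y)\<close>, the
    quartic term is differentiated by the chain rule from
    \<open>GDERIV_norm_product\<close>.\<close>
  have eq: "objective A = (\<lambda>p. 1/4 * ((fst p \<bullet> fst p) * (snd p \<bullet> snd p))\<^sup>2
      - 1/2 * biquad_form A (fst p) (snd p))"
    by (simp add: objective_def fun_eq_iff power_mult_distrib)
  show ?thesis
    unfolding eq gderiv_def
    by (rule has_derivative_eq_rhs,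
        rule has_derivative_diff[OF
          has_derivative_mult_right[OF has_derivative_power[OF GDERIV_norm_product[unfolded gderiv_def]]]
          has_derivative_mult_right[OF GDERIV_biquad_form[OF assms, unfolded gderiv_def]]])
      (auto simp: fun_eq_iff inner_prod_def inner_diff_right power2_eq_square algebra_simps)
qed

text \<open>Turns the assertion that 0 is a gradient into equations, by comparison with the computed
  gradient.\<close>

lemma GDERIV_unique:
  assumes "GDERIV f x :> D" "GDERIV f x :> E"
  shows "D = E"
proof -
  have "(\<lambda>h. h \<bullet> D) = (\<lambda>h. h \<bullet> E)"
    using assms unfolding gderiv_def by (rule has_derivative_unique)
  then show ?thesis
    unfolding fun_eq_iff vector_eq_ldot by simp
qed

lemma GDERIV_global_minimizer:
  assumes "GDERIV f x :> D" "global_minimizer f x"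
  shows "D = 0"
proof -
  have "(\<lambda>h. h \<bullet> D) = (\<lambda>h. 0)"
    using assms unfolding gderiv_def global_minimizer_def
    by (intro has_derivative_local_min[of f _ x]) auto
  then have "D \<bullet> D = 0"
    by (rule fun_cong)
  then show ?thesis
    by simp
qed

section \<open>From critical points to M-eigenvectors\<close>

lemma objective_critical_point_iff:
  assumes "hier_symmetric A"
  shows "critical_point (objective A) (x, y) \<longleftrightarrow>
           tensor_yxy A x y = ((x \<bullet> x) * (y \<bullet> y)\<^sup>2) *\<^sub>R x \<and>
           tensor_xyx A x y = ((x \<bullet> x)\<^sup>2 * (y \<bullet> y)) *\<^sub>R y"
proof -
  have "critical_point (objective A) (x, y) \<longleftrightarrow>
      (((x \<bullet> x) * (y \<bullet> y)\<^sup>2) *\<^sub>R x - tensor_yxy A x y,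
       ((x \<bullet> x)\<^sup>2 * (y \<bullet> y)) *\<^sub>R y - tensor_xyx A x y) = 0"
    unfolding critical_point_def
    using GDERIV_objective[OF assms, of x y] GDERIV_unique by metis
  then show ?thesis
    by (auto simp: zero_prod_def)
qed

text \<open>Normalizing divides \<open>tensor_yxy A x y\<close> by
  \<open>norm x * (norm y)^2\<close>, so the critical point equation leaves the factor
  \<open>(x \<bullet> x) * (y \<bullet> y)\<close> in front of \<open>x /\<^sub>R norm x\<close>;
  the second equation behaves symmetrically.\<close>

lemma critical_point_imp_M_eigen:
  assumes "hier_symmetric A" "x \<noteq> 0" "y \<noteq> 0" "critical_point (objective A) (x, y)"
  shows "M_eigen A ((x \<bullet> x) * (y \<bullet> y)) (x /\<^sub>R norm x) (y /\<^sub>R norm y)"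
proof -
  have "tensor_yxy A x y = ((x \<bullet> x) * (y \<bullet> y)\<^sup>2) *\<^sub>R x"
    and "tensor_xyx A x y = ((x \<bullet> x)\<^sup>2 * (y \<bullet> y)) *\<^sub>R y"
    using assms(4) objective_critical_point_iff[OF assms(1)] by auto
  with assms(2,3) show ?thesis
    unfolding M_eigen_def tensor_yxy_scaleR tensor_xyx_scaleR
    by (simp add: dot_square_norm power2_eq_square field_simps)
qed

lemma biquad_form_M_eigen:
  assumes "M_eigen A lam x y"
  shows "biquad_form A x y = lam"
  using assms by (simp add: M_eigen_def biquad_form_eq_inner_yxy)

section \<open>The maximum on the unit spheres as the largest M-eigenvalue\<close>

lemma exists_biquad_form_max:
  fixes A :: "real^'n^'m^'n^'m"
  obtains u v where "norm u = 1" "norm v = 1"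
    "\<And>x y. biquad_form A x y \<le> biquad_form A u v * ((x \<bullet> x) * (y \<bullet> y))"
proof -
  let ?S = "sphere 0 1 \<times> sphere 0 1 :: ((real^'m) \<times> (real^'n)) set"
  have "compact ?S"
    by (intro compact_Times compact_sphere)
  moreover have "?S \<noteq> {}"
    by simp
  moreover have "continuous_on ?S (\<lambda>p. biquad_form A (fst p) (snd p))"
    unfolding biquad_form_def by (intro continuous_intros)
  ultimately obtain p where p: "p \<in> ?S"
    and max: "\<forall>q\<in>?S. biquad_form A (fst q) (snd q) \<le> biquad_form A (fst p) (snd p)"
    using continuous_attains_sup by blast
  show ?thesis
  proof (rule that)
    show "norm (fst p) = 1" "norm (snd p) = 1"
      using p by auto
    fix x :: "real^'m" and y :: "real^'n"
    show "biquad_form A x y \<le> biquad_form A (fst p) (snd p) * ((x \<bullet> x) * (y \<bullet> y))"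
    \<comment> \<open>Normalization fails for a zero vector, but then both sides vanish.\<close>
    proof (cases "x = 0 \<or> y = 0")
      case True
      then show ?thesis
        by (auto simp: biquad_form_def)
    next
      case False
      let ?u = "x /\<^sub>R norm x" and ?v = "y /\<^sub>R norm y"
      have "biquad_form A x y = biquad_form A (norm x *\<^sub>R ?u) (norm y *\<^sub>R ?v)"
        using False by simp
      also have "\<dots> = (x \<bullet> x) * (y \<bullet> y) * biquad_form A ?u ?v"
        by (simp only: biquad_form_scaleR dot_square_norm)
      also have "\<dots> \<le> (x \<bullet> x) * (y \<bullet> y) * biquad_form A (fst p) (snd p)"
        using bspec[OF max, of "(?u, ?v)"] False by (intro mult_left_mono) auto
      finally show ?thesis
        by (simp add: mult.commute)
    qed
  qed
qed

text \<open>Homogenizing the constraints avoids Lagrange multipliers: \<open>?g\<close> below is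
  nonnegative on the whole space and zero at \<open>(u, v)\<close>, so an unconstrained minimum
  suffices.\<close>

lemma M_eigen_biquad_form_max:
  assumes "hier_symmetric A" "norm u = 1" "norm v = 1"
    and max: "\<And>x y. biquad_form A x y \<le> biquad_form A u v * ((x \<bullet> x) * (y \<bullet> y))"
  shows "M_eigen A (biquad_form A u v) u v"
proof -
  let ?M = "biquad_form A u v"
  let ?g = "\<lambda>p. ?M * ((fst p \<bullet> fst p) * (snd p \<bullet> snd p)) - biquad_form A (fst p) (snd p)"
  have unit: "u \<bullet> u = 1" "v \<bullet> v = 1"
    using assms(2,3) by (simp_all add: dot_square_norm)
  have "GDERIV ?g (u, v) :> ?M *\<^sub>R (2 *\<^sub>R u, 2 *\<^sub>R v) - (2 *\<^sub>R tensor_yxy A u v, 2 *\<^sub>R tensor_xyx A u v)"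
    using GDERIV_norm_product[of u v] GDERIV_biquad_form[OF assms(1), of u v]
    unfolding gderiv_def inner_diff_right inner_scaleR_right unit
    by (intro has_derivative_diff has_derivative_mult_right) simp_all
  moreover have "global_minimizer ?g (u, v)"
    using max by (simp add: global_minimizer_def unit)
  ultimately have "?M *\<^sub>R (2 *\<^sub>R u, 2 *\<^sub>R v) - (2 *\<^sub>R tensor_yxy A u v, 2 *\<^sub>R tensor_xyx A u v) = 0"
    by (rule GDERIV_global_minimizer)
  then have "2 *\<^sub>R tensor_yxy A u v = 2 *\<^sub>R (?M *\<^sub>R u)" "2 *\<^sub>R tensor_xyx A u v = 2 *\<^sub>R (?M *\<^sub>R v)"
    by (simp_all add: zero_prod_def mult.commute)
  then show ?thesis
    using assms(2,3) unit unfolding M_eigen_def scaleR_cancel_left by auto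
qed

text \<open>Every M-eigenvalue is the value of the form at its unit eigenvectors, hence at most the
  maximum, which is itself an M-eigenvalue.\<close>

lemma largest_M_eigenvalue_eq:
  assumes "M_eigen A (biquad_form A u v) u v"
    and max: "\<And>x y. biquad_form A x y \<le> biquad_form A u v * ((x \<bullet> x) * (y \<bullet> y))"
  shows "largest_M_eigenvalue A = biquad_form A u v"
  unfolding largest_M_eigenvalue_def
proof (rule Greatest_equality)
  show "M_eigenvalue A (biquad_form A u v)"
    using assms(1) by (auto simp: M_eigenvalue_def)
  show "lam \<le> biquad_form A u v" if eig: "M_eigenvalue A lam" for lam
  proof -
    obtain x y where "M_eigen A lam x y"
      using eig by (auto simp: M_eigenvalue_def)
    then show ?thesis
      using max[of x y] by (simp add: biquad_form_M_eigen) (simp add: M_eigen_def)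
  qed
qed

section \<open>Global minimum by reduction to a quadratic in one variable\<close>

lemma objective_lower_bound:
  assumes "\<And>x y. biquad_form A x y \<le> M * ((x \<bullet> x) * (y \<bullet> y))"
  shows "objective A (x, y) \<ge> 1/4 * ((x \<bullet> x) * (y \<bullet> y))\<^sup>2 - 1/2 * (M * ((x \<bullet> x) * (y \<bullet> y)))"
  using assms[of x y] by (simp add: objective_def power_mult_distrib)

lemma global_minimizer_objective_zero:
  assumes "\<And>x y. biquad_form A x y \<le> M * ((x \<bullet> x) * (y \<bullet> y))" "M \<le> 0"
  shows "global_minimizer (objective A) (0, 0)"
proof -
  have "0 \<le> objective A (x, y)" for x y
  proof -
    have "M * ((x \<bullet> x) * (y \<bullet> y)) \<le> 0"
      using assms(2) by (simp add: mult_nonpos_nonneg)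
    then show ?thesis
      using objective_lower_bound[OF assms(1), of x y]
        zero_le_power2[of "(x \<bullet> x) * (y \<bullet> y)"] by linarith
  qed
  then show ?thesis
    by (auto simp: global_minimizer_def objective_def biquad_form_def)
qed

text \<open>Scaling \<open>u\<close> alone by the square root gives
  \<open>(x \<bullet> x) * (y \<bullet> y)\<close> the optimal value
  \<open>M = biquad_form A u v\<close>. The form is then \<open>M^2\<close>, and the objective
  \<open>M^2/4 - M^2/2\<close>.\<close>

lemma objective_scaled_max:
  assumes "norm u = 1" "norm v = 1" "biquad_form A u v > 0"
  shows "objective A (sqrt (biquad_form A u v) *\<^sub>R u, v) = - (1/4) * (biquad_form A u v)\<^sup>2"
  using assms biquad_form_scaleR[of A "sqrt (biquad_form A u v)" u 1 v]
  by (simp add: objective_def dot_square_norm power2_eq_square)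

lemma global_minimizer_objective_scaled_max:
  assumes "norm u = 1" "norm v = 1" "biquad_form A u v > 0"
    and max: "\<And>x y. biquad_form A x y \<le> biquad_form A u v * ((x \<bullet> x) * (y \<bullet> y))"
  shows "global_minimizer (objective A) (sqrt (biquad_form A u v) *\<^sub>R u, v)"
proof -
  have "- (1/4) * (biquad_form A u v)\<^sup>2 \<le> objective A (x, y)" for x y
    \<comment> \<open>Completing the square: the lower bound exceeds \<open>- M^2/4\<close> by a
      quarter of the square named next.\<close>
    using objective_lower_bound[OF max, of x y]
      zero_le_power2[of "(x \<bullet> x) * (y \<bullet> y) - biquad_form A u v"]
    unfolding power2_diff by (simp add: algebra_simps)
  then show ?thesis
    unfolding global_minimizer_def split_paired_All objective_scaled_max[OF assms(1-3)] by blast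
qed

theorem theorem2p1:
  fixes A :: "real^'n^'m^'n^'m"
  assumes "hier_symmetric A" and "A \<noteq> 0"
  shows "(\<exists>p. global_minimizer (objective A) p) \<and>
         (\<forall>x y. x \<noteq> 0 \<longrightarrow> y \<noteq> 0 \<longrightarrow> critical_point (objective A) (x, y) \<longrightarrow>
            (x \<bullet> x) * (y \<bullet> y) > 0 \<and>
            M_eigenvalue A ((x \<bullet> x) * (y \<bullet> y)) \<and>
            M_eigen A ((x \<bullet> x) * (y \<bullet> y)) (x /\<^sub>R norm x) (y /\<^sub>R norm y)) \<and>
         (largest_M_eigenvalue A > 0 \<longrightarrow>
            (\<exists>x y. x \<noteq> 0 \<and> y \<noteq> 0 \<and> critical_point (objective A) (x, y) \<and>
               global_minimizer (objective A) (x, y) \<and>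
               objective A (x, y) = - (1/4) * (largest_M_eigenvalue A)\<^sup>2))"
proof -
  obtain u :: "real^'m" and v :: "real^'n" where uv: "norm u = 1" "norm v = 1"
    and max: "\<And>x y. biquad_form A x y \<le> biquad_form A u v * ((x \<bullet> x) * (y \<bullet> y))"
    using exists_biquad_form_max[of A] by blast
  have M: "largest_M_eigenvalue A = biquad_form A u v"
    using M_eigen_biquad_form_max[OF assms(1) uv max] max by (rule largest_M_eigenvalue_eq)
  let ?x = "sqrt (biquad_form A u v) *\<^sub>R u"
  have "\<exists>p. global_minimizer (objective A) p"
    \<comment> \<open>The sign of the maximum decides between the origin and the scaled
      maximizer.\<close>
    using global_minimizer_objective_zero[OF max] global_minimizer_objective_scaled_max[OF uv _ max]
    by (meson not_le)
  moreover have "(x \<bullet> x) * (y \<bullet> y) > 0 \<and> M_eigenvalue A ((x \<bullet> x) * (y \<bullet> y)) \<and>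
      M_eigen A ((x \<bullet> x) * (y \<bullet> y)) (x /\<^sub>R norm x) (y /\<^sub>R norm y)"
    if "x \<noteq> 0" "y \<noteq> 0" "critical_point (objective A) (x, y)" for x y
    using critical_point_imp_M_eigen[OF assms(1) that] that(1,2)
    by (auto simp: M_eigenvalue_def)
  moreover have "?x \<noteq> 0 \<and> v \<noteq> 0 \<and> critical_point (objective A) (?x, v) \<and>
      global_minimizer (objective A) (?x, v) \<and>
      objective A (?x, v) = - (1/4) * (largest_M_eigenvalue A)\<^sup>2"
    if "largest_M_eigenvalue A > 0"
  proof -
    have pos: "biquad_form A u v > 0"
      using that M by simp
    have min: "global_minimizer (objective A) (?x, v)"
      using uv pos max by (rule global_minimizer_objective_scaled_max)
    \<comment> \<open>The computed gradient exists at \<open>(?x, v)\<close> and must be 0 at a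
      global minimizer.\<close>
    then have "critical_point (objective A) (?x, v)"
      using GDERIV_objective[OF assms(1), of ?x v] GDERIV_global_minimizer
      unfolding critical_point_def by metis
    then show ?thesis
      using min pos uv objective_scaled_max[OF uv pos] M by auto
  qed
  ultimately show ?thesis
    by blast
qed

end
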